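(* For every $n\in\mathbb{N}=\{0,1,2,\ldots\}$ the polynomial $P_{n,n}$ satisfies the symmetry property $P_{n,n}(\omega x)=\omega^{2n}P_{n,n}(x)$, where $\omega=e^{2\pi i/3}$. In particular $$P_{n,n}(x)=\begin{cases}\sum_{j=0}^{2n/3}a_jx^{3j}, & n\equiv0\bmod 3,\\ x^2\sum_{j=0}^{2(n-1)/3}b_jx^{3j}, & n\equiv1\bmod 3,\\ x\sum_{j=0}^{2(n-2)/3+1}c_jx^{3j}, & n\equiv2\bmod 3,\end{cases}$$ where $(a_j)_j,(b_j)_j,(c_j)_j$ are real sequences depending on $n$. Furthermore the number of strictly positive real zeros of $P_{n,n}$ is $$\begin{cases}\frac{2n}{3}, & n\equiv0\bmod3,\\ \frac{2(n-1)}{3}, & n\equiv1\bmod3,\\ \frac{2(n-2)}{3}+1, & n\equiv2\bmod3,\end{cases}$$ and $P_{n,n}(x)$ has a zero of multiplicity one at $x=0$ when $n\equiv2\bmod3$ and a zero of multiplicity two at $x=0$ when $n\equiv1\bmod3$.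
   Context: Let $\omega=e^{2\pi i/3}$ and, for $k=0,1,2$, let $\Gamma_k=\{r\omega^k: r\ge 0\}$ be the closed ray in $\mathbb{C}$ from the origin in direction $\omega^k$. All rays are oriented from left to right, so $\Gamma_0$ goes from $0$ to $+\infty$, while $\Gamma_1,\Gamma_2$ go from infinity to $0$. Thus for $j=1,2$ $$\int_{\Gamma_0\cup\Gamma_j} f(x)\,dx=\int_0^\infty f(t)\,dt-\omega^j\int_0^\infty f(\omega^j t)\,dt .$$ $P_{n,n}$ is the (unique) monic polynomial of degree $2n$ satisfying, for both $j=1$ and $j=2$, $$\int_{\Gamma_0\cup\Gamma_j}x^iP_{n,n}(x)e^{-x^3}dx=0,\qquad i=0,1,\ldots,n-1.$$ *)

theory Defs
  imports "HOL-Analysis.Analysis" "HOL-Computational_Algebra.Polynomial"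
begin

definition omega :: complex where
  "omega = exp (2 * of_real pi * \<i> / 3)"

text \<open>
  Integral over the union of the ray from 0 in direction 1 (oriented outwards) and the
  ray in direction \<open>omega ^ j\<close> (oriented from infinity to 0, whence the minus sign).
  Each ray is parametrised by \<open>t \<ge> 0\<close>.
\<close>

definition rays_integral :: "nat \<Rightarrow> (complex \<Rightarrow> complex) \<Rightarrow> complex" where
  "rays_integral j f =
     (LBINT t:{0..}. f (of_real t)) - omega ^ j * (LBINT t:{0..}. f (omega ^ j * of_real t))"

definition is_diag_mop :: "nat \<Rightarrow> complex poly \<Rightarrow> bool" where
  "is_diag_mop n p \<longleftrightarrow>
     degree p = 2 * n \<and> lead_coeff p = 1 \<and>
     (\<forall>j\<in>{1, 2}. \<forall>i<n. rays_integral j (\<lambda>x. x ^ i * poly p x * exp (- (x ^ 3))) = 0)"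

text \<open>
  The polynomial \<open>P_{n,n}\<close>. As a definite description it is only determined once existence
  and uniqueness are established; neither is assumed.
\<close>

definition diag_mop :: "nat \<Rightarrow> complex poly" where
  "diag_mop n = (THE p. is_diag_mop n p)"

end

theory Submission
  imports Defs
begin

text \<open>On the ray in direction \<open>omega ^ j\<close> the weight is again \<open>exp (- t ^ 3)\<close>, so the orthogonality
  conditions decouple according to the exponents of the polynomial modulo 3: the part with
  exponents \<open>k \<equiv> r\<close> must be orthogonal on the half line to \<open>t ^ i\<close> for all \<open>i < n\<close> with
  \<open>i + r \<equiv> 0, 1\<close>. A nonzero real polynomial that is orthogonal to \<open>N\<close> monomials has at least \<open>N\<close>
  positive zeros, and by Descartes a polynomial with \<open>m\<close> terms has at most \<open>m - 1\<close>. Comparing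
  \<open>N\<close> with the number of available exponents, only the class \<open>r \<equiv> 2 n\<close> survives, and there
  every available coefficient is nonzero and the number of positive zeros is exactly \<open>N\<close>.\<close>

section \<open>Homogeneous linear systems with more unknowns than equations\<close>

text \<open>Gaussian elimination, one equation per induction step. It supplies both the test
  polynomial with prescribed zeros and the coefficients of the polynomial \<open>P_{n,n}\<close>
  itself.\<close>

lemma homogeneous_system_nontrivial:
  fixes A :: "'e \<Rightarrow> 's \<Rightarrow> 'a::field"
  assumes "finite E" "finite S" "card E < card S"
  shows "\<exists>c. (\<exists>s\<in>S. c s \<noteq> 0) \<and> (\<forall>e\<in>E. (\<Sum>s\<in>S. A e s * c s) = 0)"
  using assms
proof (induction E arbitrary: S A rule: finite_induct)
  case empty
  then have "S \<noteq> {}" by auto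
  then show ?case by (intro exI[of _ "\<lambda>_. 1"]) auto
next
  case (insert e E)
  show ?case
  proof (cases "\<forall>s\<in>S. A e s = 0")
    case True
    then show ?thesis using insert.IH[of S A] insert.prems insert.hyps by auto
  next
    case False
    then obtain s0 where s0: "s0 \<in> S" "A e s0 \<noteq> 0" by auto
    define S' where "S' = S - {s0}"
    have S: "S = insert s0 S'" "s0 \<notin> S'" "finite S'"
      using s0 insert.prems by (auto simp: S'_def)
    have "card E < card S'" using insert.prems insert.hyps S by auto
    \<comment> \<open>The pivot \<open>A e s0\<close> eliminates the unknown \<open>s0\<close> from
      the remaining equations.\<close>
    from insert.IH[OF S(3) this, of "\<lambda>e' s. A e' s - A e' s0 * A e s / A e s0"]
    obtain c where c: "\<exists>s\<in>S'. c s \<noteq> 0"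
      "\<And>e'. e' \<in> E \<Longrightarrow> (\<Sum>s\<in>S'. (A e' s - A e' s0 * A e s / A e s0) * c s) = 0"
      by blast
    define T where "T = (\<Sum>s\<in>S'. A e s * c s)"
    \<comment> \<open>Back substitution: this value at \<open>s0\<close> solves equation
      \<open>e\<close>.\<close>
    define c' where "c' = c(s0 := - T / A e s0)"
    have sum_c': "(\<Sum>s\<in>S. A e' s * c' s) = (\<Sum>s\<in>S'. A e' s * c s) - A e' s0 * T / A e s0" for e'
    proof -
      have "(\<Sum>s\<in>S'. A e' s * c' s) = (\<Sum>s\<in>S'. A e' s * c s)"
        using S by (intro sum.cong) (auto simp: c'_def)
      then show ?thesis using S by (simp add: c'_def)
    qed
    have "(\<Sum>s\<in>S. A e' s * c' s) = 0" if "e' \<in> E" for e'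
    proof -
      have "(\<Sum>s\<in>S'. (A e' s - A e' s0 * A e s / A e s0) * c s) =
        (\<Sum>s\<in>S'. A e' s * c s) - A e' s0 * T / A e s0"
        by (simp add: T_def left_diff_distrib sum_subtractf sum_distrib_left sum_divide_distrib
            mult.assoc)
      then show ?thesis using c(2)[OF that] sum_c' by simp
    qed
    moreover have "(\<Sum>s\<in>S. A e s * c' s) = 0"
      unfolding sum_c' using s0 by (simp add: T_def)
    moreover have "\<exists>s\<in>S. c' s \<noteq> 0" using c(1) S by (auto simp: c'_def)
    ultimately show ?thesis by blast
  qed
qed

section \<open>Rolle's theorem, the Descartes bound by number of terms, and constant sign\<close>

text \<open>Adding the points in increasing order, each new gap contributes one zero of the
  derivative. The upper bounds on \<open>B\<close> keep the new zero distinct from the old ones; the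
  lower bounds later give positivity when \<open>Z\<close> consists of positive zeros.\<close>

lemma Rolle_points:
  fixes p :: "real poly"
  assumes "finite Z" "Z \<noteq> {}" "\<forall>z\<in>Z. poly p z = 0"
  shows "\<exists>B. finite B \<and> Suc (card B) = card Z \<and> B \<inter> Z = {} \<and> (\<forall>b\<in>B. poly (pderiv p) b = 0)
    \<and> (\<forall>b\<in>B. \<exists>z\<in>Z. z < b) \<and> (\<forall>b\<in>B. \<exists>z\<in>Z. b < z)"
  using assms
proof (induction Z rule: finite_linorder_max_induct)
  case empty
  then show ?case by simp
next
  case (insert m A)
  show ?case
  proof (cases "A = {}")
    case True
    then show ?thesis by (intro exI[of _ "{}"]) auto
  next
    case False
    then obtain B where B: "finite B" "Suc (card B) = card A" "B \<inter> A = {}"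
      "\<forall>b\<in>B. poly (pderiv p) b = 0" "\<forall>b\<in>B. \<exists>z\<in>A. z < b" "\<forall>b\<in>B. \<exists>z\<in>A. b < z"
      using insert by auto
    have M: "Max A \<in> A" using False insert.hyps by simp
    then have "Max A < m" using insert.hyps by auto
    then obtain c where c: "Max A < c" "c < m" "poly (pderiv p) c = 0"
      using poly_MVT[of "Max A" m p] M insert.prems by auto
    have le: "a \<le> Max A" if "a \<in> A" for a using that insert.hyps by simp
    have BM: "b < Max A" if "b \<in> B" for b using B(6) le that by (meson less_le_trans)
    have "c \<notin> B" using BM c by force
    moreover have "c \<notin> A" using le c by force
    moreover have "m \<notin> A" "m \<notin> B" using insert.hyps BM \<open>Max A < m\<close> by force+
    moreover have "\<forall>b\<in>insert c B. \<exists>z\<in>insert m A. z < b" using B(5) c M by blast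
    moreover have "\<forall>b\<in>insert c B. \<exists>z\<in>insert m A. b < z" using B(6) c by blast
    moreover have "finite (insert c B)" "\<forall>b\<in>insert c B. poly (pderiv p) b = 0"
      using B(1,4) c(3) by simp_all
    moreover have "Suc (card (insert c B)) = card (insert m A)"
      using B(1,2) \<open>c \<notin> B\<close> \<open>m \<notin> A\<close> insert.hyps(1) by simp
    moreover have "insert c B \<inter> insert m A = {}"
      using B(3) c(2) \<open>c \<notin> A\<close> \<open>m \<notin> B\<close> by auto
    ultimately show ?thesis by (intro exI[of _ "insert c B"] conjI)
  qed
qed

lemma finite_coeff_support: "finite {k. coeff p k \<noteq> 0}"
  by (rule finite_subset[of _ "{..degree p}"]) (auto intro: le_degree)

lemma card_support_pCons_0:
  "card {k. coeff (pCons 0 p) k \<noteq> 0} = card {k. coeff p k \<noteq> 0}"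
proof -
  have "{k. coeff (pCons 0 p) k \<noteq> 0} = Suc ` {k. coeff p k \<noteq> 0}"
  proof (rule set_eqI)
    show "k \<in> {k. coeff (pCons 0 p) k \<noteq> 0} \<longleftrightarrow> k \<in> Suc ` {k. coeff p k \<noteq> 0}" for k
      by (cases k) auto
  qed
  then show ?thesis by (simp add: card_image)
qed

lemma card_support_pderiv:
  fixes p :: "real poly"
  assumes "coeff p 0 \<noteq> 0"
  shows "card {k. coeff p k \<noteq> 0} = Suc (card {k. coeff (pderiv p) k \<noteq> 0})"
proof -
  have "{k. coeff p k \<noteq> 0} = insert 0 (Suc ` {k. coeff (pderiv p) k \<noteq> 0})"
  proof (rule set_eqI)
    show "k \<in> {k. coeff p k \<noteq> 0} \<longleftrightarrow> k \<in> insert 0 (Suc ` {k. coeff (pderiv p) k \<noteq> 0})" for k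
      using assms by (cases k) (auto simp: coeff_pderiv simp del: of_nat_Suc)
  qed
  then show ?thesis by (simp add: card_image finite_coeff_support)
qed

text \<open>Induction on the degree. If the constant term vanishes, dividing by the variable changes
  neither side. Otherwise differentiation removes exactly one term and at most one positive zero:
  each point of \<open>Z\<close> loses one from its order, and Rolle returns
  \<open>card Z - 1\<close> zeros outside \<open>Z\<close>.\<close>

lemma sum_order_positive_roots_less:
  fixes p :: "real poly"
  assumes "p \<noteq> 0"
  shows "(\<Sum>x | x > 0 \<and> poly p x = 0. order x p) < card {k. coeff p k \<noteq> 0}"
  using assms
proof (induction "degree p" arbitrary: p rule: less_induct)
  case less
  define Z where "Z = {x. x > 0 \<and> poly p x = 0}"
  have "finite Z" unfolding Z_def using poly_roots_finite[OF less.prems] by simp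
  have pos: "0 < card {k. coeff p k \<noteq> 0}"
    using finite_coeff_support[of p] less.prems
    by (metis (mono_tags, lifting) card_gt_0_iff empty_iff leading_coeff_0_iff mem_Collect_eq)
  show ?case
  proof (cases "coeff p 0 = 0")
    case True
    then obtain q where q: "p = pCons 0 q" by (metis coeff_pCons_0 pCons_cases)
    then have "q \<noteq> 0" "degree q < degree p" using less.prems by auto
    note IH = less.hyps[OF this(2,1)]
    have "order x p = order x q" if "x > 0" for x
    proof -
      have p: "p = [:0, 1:] * q" by (simp add: q)
      have "order x [:0, 1:] = 0" using that by (intro order_0I) auto
      then show ?thesis unfolding p using \<open>q \<noteq> 0\<close> by (subst order_mult) auto
    qed
    then have "(\<Sum>x | x > 0 \<and> poly p x = 0. order x p) = (\<Sum>x | x > 0 \<and> poly q x = 0. order x q)"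
      by (intro sum.cong) (auto simp: q)
    then show ?thesis using IH by (simp add: q card_support_pCons_0)
  next
    case False
    show ?thesis
    proof (cases "Z = {}")
      case True
      then show ?thesis using pos by (simp add: Z_def[symmetric])
    next
      case nonempty: False
      have deg: "degree p \<noteq> 0"
      proof
        assume "degree p = 0"
        then obtain a where "p = [:a:]" by (rule degree_eq_zeroE)
        then show False using nonempty less.prems unfolding Z_def by auto
      qed
      then have p': "pderiv p \<noteq> 0" "degree (pderiv p) < degree p"
        by (auto simp: pderiv_eq_0_iff degree_pderiv)
      note IH = less.hyps[OF p'(2,1)]
      define Z' where "Z' = {x. x > 0 \<and> poly (pderiv p) x = 0}"
      have finZ': "finite Z'" unfolding Z'_def using poly_roots_finite[OF p'(1)] by simp
      obtain B where B: "finite B" "Suc (card B) = card Z" "B \<inter> Z = {}"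
        "\<forall>b\<in>B. poly (pderiv p) b = 0" "\<forall>b\<in>B. \<exists>z\<in>Z. z < b"
        using Rolle_points[OF \<open>finite Z\<close> nonempty, of p] unfolding Z_def by auto
      have "B \<subseteq> Z'" using B(4,5) unfolding Z'_def Z_def by fastforce
      have ord: "order x p = Suc (order x (pderiv p))" if "x \<in> Z" for x
        using that less.prems unfolding Z_def by (intro order_pderiv) auto
      have "(\<Sum>x\<in>Z. order x p) = (\<Sum>x\<in>Z. order x (pderiv p)) + card Z"
        using ord by (simp add: sum_Suc)
      also have "(\<Sum>x\<in>Z. order x (pderiv p)) = (\<Sum>x\<in>Z \<inter> Z'. order x (pderiv p))"
      proof -
        have "order x (pderiv p) = 0" if "x \<in> Z" "x \<notin> Z'" for x
          using that by (intro order_0I) (auto simp: Z_def Z'_def)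
        then show ?thesis using \<open>finite Z\<close> by (intro sum.mono_neutral_right) auto
      qed
      also have "card Z = Suc (\<Sum>x\<in>B. 1)" using B(2) by simp
      also have "(\<Sum>x\<in>B. 1) \<le> (\<Sum>x\<in>B. order x (pderiv p))"
        using \<open>B \<subseteq> Z'\<close> p'(1) unfolding Z'_def
        by (intro sum_mono) (auto simp: order_root Suc_le_eq)
      finally have "(\<Sum>x\<in>Z. order x p) \<le>
          Suc ((\<Sum>x\<in>Z \<inter> Z'. order x (pderiv p)) + (\<Sum>x\<in>B. order x (pderiv p)))"
        by simp
      also have "(\<Sum>x\<in>Z \<inter> Z'. order x (pderiv p)) + (\<Sum>x\<in>B. order x (pderiv p)) =
          (\<Sum>x\<in>(Z \<inter> Z') \<union> B. order x (pderiv p))"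
        using B \<open>finite Z\<close> by (intro sum.union_disjoint[symmetric]) auto
      also have "\<dots> \<le> (\<Sum>x\<in>Z'. order x (pderiv p))"
        using finZ' \<open>B \<subseteq> Z'\<close> by (intro sum_mono2) auto
      finally show ?thesis
        using IH card_support_pderiv[OF False] unfolding Z_def Z'_def by simp
    qed
  qed
qed

text \<open>A positive zero of even order allows a squared linear factor to be split off without
  affecting signs or parities. Once no positive zero is left, the intermediate value theorem
  applies.\<close>

lemma even_orders_imp_constant_sign:
  fixes p :: "real poly"
  assumes "p \<noteq> 0" "\<forall>x>0. even (order x p)"
  shows "(\<forall>x>0. 0 \<le> poly p x) \<or> (\<forall>x>0. poly p x \<le> 0)"
  using assms
proof (induction "degree p" arbitrary: p rule: less_induct)
  case less
  show ?case
  proof (cases "\<exists>z>0. poly p z = 0")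
    case True
    then obtain z where z: "z > 0" "poly p z = 0" by auto
    then have "order z p \<noteq> 0" using less.prems(1) by (simp add: order_root)
    then have "2 \<le> order z p" using less.prems(2) z(1) by (metis One_nat_def even_Suc
          even_zero less_2_cases not_le)
    then have "[:-z, 1:] ^ 2 dvd p" by (simp add: order_divides)
    then obtain q where q: "p = [:-z, 1:] ^ 2 * q" by auto
    then have "q \<noteq> 0" using less.prems(1) by auto
    have "degree q < degree p"
      using \<open>q \<noteq> 0\<close> unfolding q by (subst degree_mult_eq) (auto simp: degree_power_eq)
    have "even (order x q)" if "x > 0" for x
    proof -
      have "order x p = order x ([:-z, 1:] ^ 2) + order x q"
        unfolding q using less.prems(1) q by (intro order_mult) auto
      also have "order x ([:-z, 1:] ^ 2) = 2 * order x [:-z, 1:]"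
        unfolding power2_eq_square by (subst order_mult) auto
      finally show ?thesis using less.prems(2) that by fastforce
    qed
    with less.hyps[OF \<open>degree q < degree p\<close> \<open>q \<noteq> 0\<close>]
    have "(\<forall>x>0. 0 \<le> poly q x) \<or> (\<forall>x>0. poly q x \<le> 0)" by blast
    then show ?thesis
      by (auto simp: q mult_nonneg_nonpos)
  next
    case False
    show ?thesis
    proof (rule ccontr)
      assume "\<not> ?thesis"
      then obtain x y where xy: "x > 0" "y > 0" "poly p x < 0" "poly p y > 0"
        by (auto simp: not_le)
      then consider "x < y" | "y < x" by (metis less_asym neqE)
      then show False
      proof cases
        case 1
        then obtain w where "x < w" "poly p w = 0" using poly_IVT_pos[of x y p] xy by auto
        then show False using False xy by force
      next
        case 2
        then obtain w where "y < w" "poly p w = 0" using poly_IVT_neg[of y x p] xy by auto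
        then show False using False xy by force
      qed
    qed
  qed
qed

section \<open>Moments of the weight \<open>exp (- t ^ 3)\<close> on the half line and zeros of
  orthogonal polynomials\<close>

text \<open>From \<open>x <= 1 + x ^ 3\<close> for positive \<open>x\<close>, the integrand is at
  most \<open>exp 1\<close> times \<open>x ^ m * exp (- x)\<close>, the Gamma integrand at
  \<open>m + 1\<close>. The endpoint 0 is a null set.\<close>

lemma set_integrable_moment:
  "set_integrable lborel {0..} (\<lambda>t::real. t ^ m * exp (- (t ^ 3)))"
proof -
  let ?g = "\<lambda>t. of_real (t ^ m * exp (- t)) :: complex"
  have "(\<lambda>t. complex_of_real t powr (of_nat (Suc m) - 1) / of_real (exp t))
      absolutely_integrable_on {0<..}"
    by (rule absolutely_integrable_Gamma_integral') simp
  also have "?this \<longleftrightarrow> ?g absolutely_integrable_on {0<..}"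
    by (intro set_integrable_cong) (auto simp: powr_nat' exp_minus divide_inverse)
  finally have "integrable lborel (\<lambda>t. indicator {0<..} t *\<^sub>R ?g t)"
    unfolding set_integrable_def by (subst (asm) integrable_completion) auto
  then have "integrable lborel (\<lambda>t. exp 1 *\<^sub>R (indicator {0<..} t *\<^sub>R ?g t))"
    by (rule integrable_scaleR_right)
  then show ?thesis
    unfolding set_integrable_def
  proof (rule Bochner_Integration.integrable_bound)
    show "AE x in lborel. norm (indicator {0..} x *\<^sub>R (x ^ m * exp (- (x ^ 3)))) \<le>
        norm (exp 1 *\<^sub>R (indicator {0<..} x *\<^sub>R ?g x))"
      using AE_lborel_singleton[of "0::real"]
    proof eventually_elim
      case (elim x)
      show ?case
      proof (cases "x > 0")
        case x: True
        have "x \<le> 1 + x ^ 3"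
        proof (cases "x \<le> 1")
          case False
          then have "x ^ 1 \<le> x ^ 3" by (intro power_increasing) auto
          then show ?thesis by simp
        next
          case True
          then show ?thesis using x by (simp add: add_increasing2)
        qed
        then have "exp (- (x ^ 3)) \<le> exp (1 - x)" by simp
        then have "x ^ m * exp (- (x ^ 3)) \<le> x ^ m * exp (1 - x)"
          using x by (intro mult_left_mono) auto
        then show ?thesis
          using x by (simp add: exp_diff exp_minus divide_inverse mult_ac abs_mult norm_mult
              norm_power norm_inverse)
      qed (use elim in auto)
    qed
  qed measurable
qed

text \<open>A functional on polynomials rather than on functions, so that it is linear without
  integrability side conditions.\<close>

definition mom :: "real poly \<Rightarrow> real" where
  "mom p = (LBINT t:{0..}. poly p t * exp (- (t ^ 3)))"

lemma set_integrable_poly: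
  "set_integrable lborel {0..} (\<lambda>t::real. poly p t * exp (- (t ^ 3)))"
proof -
  have "integrable lborel (\<lambda>t. \<Sum>k\<le>degree p. coeff p k * (indicator {0..} t * (t ^ k * exp (- (t ^ 3)))))"
    using set_integrable_moment by (intro Bochner_Integration.integrable_sum integrable_mult_right)
      (auto simp: set_integrable_def)
  then show ?thesis
    unfolding set_integrable_def
    by (simp add: poly_altdef sum_distrib_left sum_distrib_right mult_ac)
qed

lemma mom_add: "mom (p + q) = mom p + mom q"
  unfolding mom_def using set_integrable_poly[of p] set_integrable_poly[of q]
  by (simp add: distrib_right set_integral_add)

lemma mom_smult: "mom (smult c p) = c * mom p"
  unfolding mom_def by (simp add: mult.assoc)

lemma mom_0 [simp]: "mom 0 = 0"
  by (simp add: mom_def)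

lemma mom_sum: "mom (\<Sum>i\<in>A. f i) = (\<Sum>i\<in>A. mom (f i))"
  by (induction A rule: infinite_finite_induct) (auto simp: mom_add)

text \<open>A nonnegative integrand with integral 0 vanishes almost everywhere. A nonzero polynomial
  has only finitely many zeros, so the half line would be a null set.\<close>

lemma mom_eq_0_imp_eq_0:
  assumes "mom p = 0" "\<forall>x>0. 0 \<le> poly p x"
  shows "p = 0"
proof (rule ccontr)
  assume "p \<noteq> 0"
  let ?f = "\<lambda>t::real. indicator {0..} t *\<^sub>R (poly p t * exp (- (t ^ 3)))"
  have int: "integrable lborel ?f" using set_integrable_poly[of p] by (simp add: set_integrable_def)
  have "AE t in lborel. 0 \<le> ?f t"
    using AE_lborel_singleton[of "0::real"]
    by eventually_elim (use assms(2) in \<open>auto simp: indicator_def\<close>)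
  moreover have "integral\<^sup>L lborel ?f = 0"
    using assms(1) by (simp add: mom_def set_lebesgue_integral_def)
  ultimately have "AE t in lborel. ?f t = 0"
    using integral_nonneg_eq_0_iff_AE[OF int] by blast
  moreover have "AE t in lborel. t \<notin> {t. poly p t = 0}"
    using poly_roots_finite[OF \<open>p \<noteq> 0\<close>]
    by (intro AE_not_in) (auto simp: null_sets_def emeasure_lborel_countable countable_finite
         intro!: borel_closed finite_imp_closed)
  ultimately have "AE t in lborel. t \<notin> {0::real..}"
    by eventually_elim (auto simp: indicator_def)
  then have "AE t in lborel. t \<notin> {0::real..1}" by eventually_elim auto
  then have "emeasure lborel {0::real..1} = 0"
    by (subst (asm) AE_iff_measurable[of "{0..1}"]) auto
  then show False by simp
qed

text \<open>If \<open>Q\<close> had too few sign changes, the fewnomial bound would provide a combination \<open>G\<close> of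
  the test monomials that changes sign exactly where \<open>Q\<close> does, so that \<open>Q * G\<close> has constant sign
  although its integral vanishes.\<close>

lemma card_le_positive_roots:
  assumes "Q \<noteq> 0" "finite I" "\<forall>i\<in>I. mom (monom 1 i * Q) = 0"
  shows "card I \<le> card {x. x > 0 \<and> poly Q x = 0}"
proof (rule ccontr)
  assume less: "\<not> ?thesis"
  \<comment> \<open>Only zeros of odd order are sign changes.\<close>
  define Z where "Z = {x. x > 0 \<and> odd (order x Q)}"
  have fin: "finite {x. x > 0 \<and> poly Q x = 0}"
    using poly_roots_finite[OF assms(1)] by simp
  have Z_roots: "Z \<subseteq> {x. x > 0 \<and> poly Q x = 0}"
    using assms(1) by (auto simp: Z_def order_root odd_pos)
  have "finite Z" using Z_roots fin by (rule finite_subset)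
  have "Suc (card Z) \<le> card I" using less card_mono[OF fin Z_roots] by simp
  then obtain J where J: "J \<subseteq> I" "card J = Suc (card Z)" "finite J"
    by (rule obtain_subset_with_card_n)
  have "card Z < card J" using J by simp
  \<comment> \<open>One more coefficient than there are points in \<open>Z\<close>, so some nonzero
    combination vanishes at all of them.\<close>
  from homogeneous_system_nontrivial[OF \<open>finite Z\<close> J(3) this, of "\<lambda>z i. z ^ i"]
  obtain c where c: "\<exists>i\<in>J. c i \<noteq> 0" "\<forall>z\<in>Z. (\<Sum>i\<in>J. z ^ i * c i) = 0" by blast
  define G where "G = (\<Sum>i\<in>J. smult (c i) (monom 1 i))"
  have coeff_G: "coeff G k = (if k \<in> J then c k else 0)" for k
    using J(3) unfolding G_def by (simp add: coeff_sum coeff_monom if_distrib cong: if_cong)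
  have "G \<noteq> 0" using c(1) coeff_G by (metis coeff_0)
  define S where "S = {x. x > 0 \<and> poly G x = 0}"
  have "finite S" unfolding S_def using poly_roots_finite[OF \<open>G \<noteq> 0\<close>] by simp
  have "Z \<subseteq> S"
    using c(2) by (auto simp: S_def Z_def G_def poly_sum poly_monom mult.commute)
  \<comment> \<open>With at most \<open>card Z + 1\<close> terms, \<open>G\<close> has at most
    \<open>card Z\<close> positive zeros counted with multiplicity. As it vanishes on
    \<open>Z\<close>, its positive zeros are exactly \<open>Z\<close>, all simple.\<close>
  have "card {k. coeff G k \<noteq> 0} \<le> card J"
    using J(3) by (intro card_mono) (auto simp: coeff_G split: if_splits)
  with sum_order_positive_roots_less[OF \<open>G \<noteq> 0\<close>] have sum_le: "(\<Sum>x\<in>S. order x G) \<le> card Z"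
    using J(2) unfolding S_def by simp
  have ge1: "1 \<le> order x G" if "x \<in> S" for x
    using that \<open>G \<noteq> 0\<close> unfolding S_def by (auto simp: order_root Suc_le_eq)
  have "card S = (\<Sum>x\<in>S. 1)" by simp
  also have "\<dots> \<le> (\<Sum>x\<in>S. order x G)" using ge1 by (rule sum_mono)
  finally have "card S \<le> card Z" using sum_le by simp
  then have "Z = S" using card_seteq[OF \<open>finite S\<close> \<open>Z \<subseteq> S\<close>] by simp
  have eq1: "order x G = 1" if "x \<in> S" for x
  proof (rule ccontr)
    assume "order x G \<noteq> 1"
    then have "1 < order x G" using ge1[OF that] by simp
    then have "(\<Sum>x\<in>S. 1) < (\<Sum>x\<in>S. order x G)"
      using that ge1 \<open>finite S\<close> by (intro sum_strict_mono_ex1) auto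
    then show False using sum_le \<open>Z = S\<close> by simp
  qed
  have QG: "Q * G \<noteq> 0" using assms(1) \<open>G \<noteq> 0\<close> by simp
  have "even (order x (Q * G))" if "x > 0" for x
  proof (cases "x \<in> Z")
    case True
    then have "order x G = 1" using eq1 \<open>Z = S\<close> by blast
    then show ?thesis using True unfolding order_mult[OF QG] by (simp add: Z_def)
  next
    case False
    then have "order x G = 0" using that \<open>Z = S\<close> by (intro order_0I) (auto simp: S_def)
    then show ?thesis using False that unfolding order_mult[OF QG] by (simp add: Z_def)
  qed
  with even_orders_imp_constant_sign[OF QG]
  have sgn: "(\<forall>x>0. 0 \<le> poly (Q * G) x) \<or> (\<forall>x>0. poly (Q * G) x \<le> 0)" by blast
  have "Q * G = (\<Sum>i\<in>J. smult (c i) (monom 1 i * Q))"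
    unfolding G_def by (simp add: sum_distrib_left mult.commute)
  then have mom0: "mom (Q * G) = 0"
    using assms(3) J(1) by (auto simp: mom_sum mom_smult intro!: sum.neutral)
  from sgn show False
  proof
    assume "\<forall>x>0. 0 \<le> poly (Q * G) x"
    then show False using mom_eq_0_imp_eq_0 mom0 QG by blast
  next
    assume "\<forall>x>0. poly (Q * G) x \<le> 0"
    then have "smult (- 1) (Q * G) = 0"
      using mom0 by (intro mom_eq_0_imp_eq_0) (auto simp: mom_smult
          simp del: mult_smult_left mult_smult_right smult_minus_left)
    then show False using QG by simp
  qed
qed

section \<open>Counting coefficients against conditions in each residue class modulo 3\<close>

definition coeff_exps :: "nat \<Rightarrow> nat \<Rightarrow> nat set" where
  "coeff_exps n r = {k. k \<le> 2 * n \<and> k mod 3 = r}"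

text \<open>The conditions that involve the class \<open>r\<close>. The excluded residue 2 is the
  one for which the contributions of the rays cancel.\<close>

definition test_exps :: "nat \<Rightarrow> nat \<Rightarrow> nat set" where
  "test_exps n r = {i. i < n \<and> (i + r) mod 3 \<noteq> 2}"

lemma finite_exps [simp]: "finite (coeff_exps n r)" "finite (test_exps n r)"
  by (auto simp: coeff_exps_def test_exps_def)

text \<open>Passing to \<open>Suc n\<close> adds the exponents \<open>2 * n + 1\<close> and
  \<open>2 * n + 2\<close> and at most the one test index \<open>n\<close>. Whether each falls in
  the class depends only on \<open>n mod 3\<close>, which leaves nine cases.\<close>

lemma card_exps:
  assumes "r < 3"
  shows "card (coeff_exps n r) = card (test_exps n r) + (if r = 2 * n mod 3 then 1 else 0)"
proof (induction n)
  case 0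
  have "coeff_exps 0 r = (if r = 0 then {0} else {})" by (auto simp: coeff_exps_def)
  then show ?case by (simp add: test_exps_def)
next
  case (Suc n)
  define x where "x = n mod 3"
  have mods: "(2 * n) mod 3 = (2 * x) mod 3" "(2 * n + 1) mod 3 = (2 * x + 1) mod 3"
    "(2 * n + 2) mod 3 = (2 * x + 2) mod 3" "(n + r) mod 3 = (x + r) mod 3"
    unfolding x_def by (metis mod_add_left_eq mod_mult_right_eq)+
  have "coeff_exps (Suc n) r = coeff_exps n r \<union> {k \<in> {2 * n + 1, 2 * n + 2}. k mod 3 = r}"
    by (auto simp: coeff_exps_def)
  then have "card (coeff_exps (Suc n) r) =
      card (coeff_exps n r) + card {k \<in> {2 * n + 1, 2 * n + 2}. k mod 3 = r}"
    by (simp only:, intro card_Un_disjoint) (auto simp: coeff_exps_def)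
  also have "{k \<in> {2 * n + 1, 2 * n + 2}. k mod 3 = r} =
      (if (2 * n + 1) mod 3 = r then {2 * n + 1} else {}) \<union>
      (if (2 * n + 2) mod 3 = r then {2 * n + 2} else {})"
    by auto
  also have "card \<dots> = (if (2 * n + 1) mod 3 = r then 1 else 0) + (if (2 * n + 2) mod 3 = r then 1 else 0)"
    by auto
  finally have coeff: "card (coeff_exps (Suc n) r) = card (coeff_exps n r) +
      ((if (2 * x + 1) mod 3 = r then 1 else 0) + (if (2 * x + 2) mod 3 = r then 1 else 0))"
    unfolding mods .
  have "test_exps (Suc n) r = (if (n + r) mod 3 \<noteq> 2 then insert n (test_exps n r) else test_exps n r)"
    by (auto simp: less_Suc_eq test_exps_def)
  moreover have "n \<notin> test_exps n r" by (simp add: test_exps_def)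
  ultimately have test: "card (test_exps (Suc n) r) =
      card (test_exps n r) + (if (x + r) mod 3 \<noteq> 2 then 1 else 0)"
    unfolding mods by simp
  have Suc_mod: "2 * Suc n mod 3 = (2 * x + 2) mod 3" using mods(3) by simp
  have "x < 3" by (simp add: x_def)
  with assms have "r = 0 \<or> r = 1 \<or> r = 2" "x = 0 \<or> x = 1 \<or> x = 2" by linarith+
  then show ?case
    using Suc.IH unfolding coeff test mods Suc_mod by (elim disjE) simp_all
qed

abbreviation moment :: "nat \<Rightarrow> real" where
  "moment m \<equiv> mom (monom 1 m)"

text \<open>Generic in the ring, so that the same coefficients yield a real polynomial, whose zeros
  are counted, and its complex counterpart.\<close>

definition poly_on :: "nat set \<Rightarrow> (nat \<Rightarrow> 'a::comm_ring_1) \<Rightarrow> 'a poly" where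
  "poly_on S c = (\<Sum>k\<in>S. monom (c k) k)"

lemma coeff_poly_on: "finite S \<Longrightarrow> coeff (poly_on S c) k = (if k \<in> S then c k else 0)"
  unfolding poly_on_def by (simp add: coeff_sum coeff_monom)

lemma mom_monom_mult_poly_on: "mom (monom 1 i * poly_on S c) = (\<Sum>k\<in>S. moment (i + k) * c k)"
proof -
  have "monom 1 i * poly_on S c = (\<Sum>k\<in>S. smult (c k) (monom 1 (i + k)))"
    unfolding poly_on_def by (simp add: sum_distrib_left mult_monom smult_monom)
  then show ?thesis by (simp add: mom_sum mom_smult mult.commute)
qed

text \<open>With \<open>N = card (test_exps n r)\<close>, orthogonality gives at least
  \<open>N\<close> positive zeros, Descartes gives fewer zeros than terms, and at most
  \<open>N + 1\<close> terms are available. All inequalities are therefore tight, which is possible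
  only in the class of \<open>2 * n\<close>.\<close>

lemma orthogonal_coeffs:
  fixes c :: "nat \<Rightarrow> real"
  assumes r: "r < 3"
    and orth: "\<forall>i\<in>test_exps n r. (\<Sum>k\<in>coeff_exps n r. moment (i + k) * c k) = 0"
    and nz: "\<exists>k\<in>coeff_exps n r. c k \<noteq> 0"
  shows "r = 2 * n mod 3" "\<forall>k\<in>coeff_exps n r. c k \<noteq> 0"
    "card {x. x > 0 \<and> poly (poly_on (coeff_exps n r) c) x = 0} = card (test_exps n r)"
proof -
  define Q where "Q = poly_on (coeff_exps n r) c"
  have coeff_Q: "coeff Q k = (if k \<in> coeff_exps n r then c k else 0)" for k
    by (simp add: Q_def coeff_poly_on)
  have "Q \<noteq> 0" using nz coeff_Q by (metis coeff_0)
  define S where "S = {k. coeff Q k \<noteq> 0}"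
  have "S \<subseteq> coeff_exps n r" by (auto simp: S_def coeff_Q split: if_splits)
  then have le: "card S \<le> card (coeff_exps n r)" by (intro card_mono) auto
  define Z where "Z = {x. x > 0 \<and> poly Q x = 0}"
  have "card (test_exps n r) \<le> card Z"
    unfolding Z_def using \<open>Q \<noteq> 0\<close> orth
    by (intro card_le_positive_roots) (auto simp: Q_def mom_monom_mult_poly_on)
  moreover have "card Z < card S"
  proof -
    have "card Z = (\<Sum>x\<in>Z. 1)" by simp
    also have "\<dots> \<le> (\<Sum>x\<in>Z. order x Q)"
      using \<open>Q \<noteq> 0\<close> by (intro sum_mono) (auto simp: Z_def order_root Suc_le_eq)
    also have "\<dots> < card S"
      unfolding Z_def S_def by (rule sum_order_positive_roots_less[OF \<open>Q \<noteq> 0\<close>])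
    finally show ?thesis .
  qed
  moreover note le card_exps[OF r, of n]
  ultimately have eqs: "r = 2 * n mod 3" "card S = card (coeff_exps n r)"
    "card Z = card (test_exps n r)"
    by (auto split: if_splits)
  show "r = 2 * n mod 3" by fact
  have "S = coeff_exps n r" using \<open>S \<subseteq> _\<close> eqs(2) by (intro card_subset_eq) auto
  then show "\<forall>k\<in>coeff_exps n r. c k \<noteq> 0" by (auto simp: S_def coeff_Q split: if_splits)
  show "card {x. x > 0 \<and> poly (poly_on (coeff_exps n r) c) x = 0} = card (test_exps n r)"
    using eqs(3) by (simp add: Z_def Q_def)
qed

section \<open>Contour integrals as combinations of real moments\<close>

lemma omega_cubed: "omega ^ 3 = 1"
  using exp_two_pi_i by (simp add: omega_def mult_ac flip: exp_of_nat_mult)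

lemma omega_neq_1: "omega \<noteq> 1"
proof -
  have "Im omega = sin (2 * pi / 3)" by (simp add: omega_def Im_exp)
  also have "\<dots> = sqrt 3 / 2" by (rule sin_120)
  finally show ?thesis by auto
qed

text \<open>As \<open>u ^ 3 = 1\<close>, the weight on the ray is \<open>exp (- t ^ 3)\<close>, and
  the direction enters only through powers of \<open>u\<close>.\<close>

lemma ray_integral:
  fixes u :: complex
  assumes "u ^ 3 = 1" "degree p \<le> d"
  shows "(LBINT t:{0..}. (u * of_real t) ^ i * poly p (u * of_real t) * exp (- ((u * of_real t) ^ 3)))
    = (\<Sum>k\<le>d. coeff p k * u ^ (i + k) * of_real (moment (i + k)))"
proof -
  have poly_eq: "poly p x = (\<Sum>k\<le>d. coeff p k * x ^ k)" for x
    unfolding poly_altdef using assms(2)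
    by (intro sum.mono_neutral_left) (auto simp: coeff_eq_0)
  have "(LBINT t:{0..}. (u * of_real t) ^ i * poly p (u * of_real t) * exp (- ((u * of_real t) ^ 3)))
    = (\<integral>t. (\<Sum>k\<le>d. coeff p k * u ^ (i + k) *
          of_real (indicator {0..} t *\<^sub>R (t ^ (i + k) * exp (- (t ^ 3))))) \<partial>lborel)"
    unfolding set_lebesgue_integral_def
  proof (intro Bochner_Integration.integral_cong refl)
    fix t :: real
    have "(u * of_real t) ^ i * (coeff p k * (u * of_real t) ^ k) * exp (- ((u * of_real t) ^ 3))
        = coeff p k * u ^ (i + k) * of_real (t ^ (i + k) * exp (- (t ^ 3)))" for k
      by (simp add: power_mult_distrib assms(1) power_add exp_of_real[symmetric] mult_ac)
    then have "(u * of_real t) ^ i * poly p (u * of_real t) * exp (- ((u * of_real t) ^ 3))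
        = (\<Sum>k\<le>d. coeff p k * u ^ (i + k) * of_real (t ^ (i + k) * exp (- (t ^ 3))))"
      unfolding poly_eq sum_distrib_left sum_distrib_right by (intro sum.cong refl)
    then show "indicator {0..} t *\<^sub>R ((u * of_real t) ^ i * poly p (u * of_real t) * exp (- ((u * of_real t) ^ 3)))
        = (\<Sum>k\<le>d. coeff p k * u ^ (i + k) *
          of_real (indicator {0..} t *\<^sub>R (t ^ (i + k) * exp (- (t ^ 3)))))"
      by (cases "t \<ge> 0") simp_all
  qed
  also have "\<dots> = (\<Sum>k\<le>d. \<integral>t. coeff p k * u ^ (i + k) *
          of_real (indicator {0..} t *\<^sub>R (t ^ (i + k) * exp (- (t ^ 3)))) \<partial>lborel)"
    using set_integrable_moment unfolding set_integrable_def
    by (intro Bochner_Integration.integral_sum integrable_mult_right integrable_of_real) auto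
  also have "\<dots> = (\<Sum>k\<le>d. coeff p k * u ^ (i + k) * of_real (moment (i + k)))"
    by (simp only: integral_mult_right_zero integral_complex_of_real)
       (simp add: mom_def poly_monom set_lebesgue_integral_def)
  finally show ?thesis .
qed

lemma rays_integral_eq:
  fixes p :: "complex poly" and i :: nat
  assumes "degree p \<le> d"
  defines "T \<equiv> \<lambda>s. \<Sum>k | k \<le> d \<and> (i + k) mod 3 = s. of_real (moment (i + k)) * coeff p k"
  shows "rays_integral j (\<lambda>x. x ^ i * poly p x * exp (- (x ^ 3)))
    = (1 - omega ^ j) * T 0 + (1 - (omega ^ j) ^ 2) * T 1"
proof -
  define u where "u = omega ^ j"
  have u3: "u ^ 3 = 1"
    unfolding u_def by (simp add: power_mult[symmetric] mult.commute[of j] omega_cubed power_mult)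
  \<comment> \<open>The successor accounts for the factor \<open>omega ^ j\<close> in front of the
    second integral.\<close>
  have u_mod: "u ^ Suc m = u ^ Suc (m mod 3)" for m
  proof -
    have "u ^ m = u ^ (3 * (m div 3) + m mod 3)" by simp
    also have "\<dots> = u ^ (m mod 3)" unfolding power_add power_mult u3 by simp
    finally show ?thesis by simp
  qed
  \<comment> \<open>The common factor of all terms with \<open>i + k\<close> in class
    \<open>s\<close>; \<open>g 2 = 1 - u ^ 3 = 0\<close> makes the third class disappear.\<close>
  define g where "g s = 1 - u ^ Suc s" for s
  have "rays_integral j (\<lambda>x. x ^ i * poly p x * exp (- (x ^ 3))) =
      (\<Sum>k\<le>d. g ((i + k) mod 3) * (of_real (moment (i + k)) * coeff p k))"
    using ray_integral[OF _ assms(1), of 1 i] ray_integral[OF u3 assms(1), of i]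
    unfolding rays_integral_def u_def[symmetric] g_def u_mod[symmetric]
    by (simp add: sum_distrib_left sum_subtractf[symmetric] algebra_simps)
  also have "\<dots> = (\<Sum>s<3. \<Sum>k | k \<in> {..d} \<and> (i + k) mod 3 = s.
      g ((i + k) mod 3) * (of_real (moment (i + k)) * coeff p k))"
    by (intro sum.group[symmetric]) auto
  also have "\<dots> = (\<Sum>s<3. g s * T s)"
    unfolding T_def by (intro sum.cong refl) (simp add: sum_distrib_left)
  also have "\<dots> = (1 - u) * T 0 + (1 - u ^ 2) * T 1"
    using u3 by (simp add: numeral_3_eq_3 g_def power2_eq_square)
  finally show ?thesis by (simp add: u_def)
qed

text \<open>The two contours give two independent linear equations for the partial moment sums
  over \<open>i + k \<equiv> 0\<close> and \<open>i + k \<equiv> 1\<close> modulo 3. The class \<open>i + k \<equiv> 2\<close> drops out, since there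
  the integrals over all three rays agree.\<close>

lemma rays_orthogonal_iff:
  fixes p :: "complex poly"
  assumes "degree p \<le> 2 * n"
  shows "(\<forall>j\<in>{1, 2}. rays_integral j (\<lambda>x. x ^ i * poly p x * exp (- (x ^ 3))) = 0) \<longleftrightarrow>
    (\<forall>r<3. (i + r) mod 3 \<noteq> 2 \<longrightarrow> (\<Sum>k\<in>coeff_exps n r. of_real (moment (i + k)) * coeff p k) = 0)"
proof -
  define T where "T s = (\<Sum>k | k \<le> 2 * n \<and> (i + k) mod 3 = s. of_real (moment (i + k)) * coeff p k)" for s
  have T_eq: "T ((i + r) mod 3) = (\<Sum>k\<in>coeff_exps n r. of_real (moment (i + k)) * coeff p k)"
    if "r < 3" for r
  proof -
    have "(i + k) mod 3 = (i + r) mod 3 \<longleftrightarrow> k mod 3 = r" for k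
    proof -
      from that consider "r = 0" | "r = 1" | "r = 2" by linarith
      then show ?thesis by cases (simp, presburger+)
    qed
    then show ?thesis unfolding T_def coeff_exps_def by simp
  qed
  \<comment> \<open>This power occurs for \<open>j = 2\<close> as
    \<open>(omega ^ 2) ^ 2\<close>.\<close>
  have w: "omega ^ 4 = omega"
    using power_add[of omega 3 1] by (simp add: omega_cubed)
  have "(\<forall>j\<in>{1, 2}. rays_integral j (\<lambda>x. x ^ i * poly p x * exp (- (x ^ 3))) = 0) \<longleftrightarrow>
      (1 - omega) * T 0 + (1 - omega ^ 2) * T 1 = 0 \<and>
      (1 - omega ^ 2) * T 0 + (1 - omega) * T 1 = 0"
    unfolding rays_integral_eq[OF assms] T_def[symmetric]
    by (simp add: w flip: power_mult)
  also have "\<dots> \<longleftrightarrow> T 0 = 0 \<and> T 1 = 0"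
  proof
    assume *: "(1 - omega) * T 0 + (1 - omega ^ 2) * T 1 = 0 \<and>
      (1 - omega ^ 2) * T 0 + (1 - omega) * T 1 = 0"
    have "(omega - 1) * (omega ^ 2 + omega + 1) = 0"
      using omega_cubed by (simp add: algebra_simps power2_eq_square power3_eq_cube)
    then have "omega ^ 2 + omega + 1 = 0"
      unfolding mult_eq_0_iff using omega_neq_1 by simp
    then have w2: "omega ^ 2 = - 1 - omega" by algebra
    \<comment> \<open>Cramer's rule: the determinant
      \<open>(1 - omega) ^ 2 - (1 - omega ^ 2) ^ 2\<close> equals
      \<open>- 3 * (2 * omega + 1)\<close>.\<close>
    have "3 * (2 * omega + 1) * T 0 = 0" "3 * (2 * omega + 1) * T 1 = 0"
      using * w2 by algebra+
    moreover have "2 * omega + 1 \<noteq> 0"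
    proof
      assume "2 * omega + 1 = 0"
      \<comment> \<open>Since
        \<open>4 * (omega ^ 2 + omega + 1) = (2 * omega + 1) ^ 2 + 3\<close>.\<close>
      then have "(3::complex) = 0" using w2 by algebra
      then show False by simp
    qed
    ultimately show "T 0 = 0 \<and> T 1 = 0" by (metis mult_eq_0_iff zero_neq_numeral)
  qed simp
  also have "\<dots> \<longleftrightarrow> (\<forall>r<3. (i + r) mod 3 \<noteq> 2 \<longrightarrow> T ((i + r) mod 3) = 0)"
  proof
    assume "T 0 = 0 \<and> T 1 = 0"
    moreover have "m mod 3 = 0 \<or> m mod 3 = 1 \<or> m mod 3 = 2" for m :: nat by presburger
    ultimately show "\<forall>r<3. (i + r) mod 3 \<noteq> 2 \<longrightarrow> T ((i + r) mod 3) = 0" by metis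
  next
    assume *: "\<forall>r<3. (i + r) mod 3 \<noteq> 2 \<longrightarrow> T ((i + r) mod 3) = 0"
    \<comment> \<open>For every \<open>i\<close>, residues 0 and 1 are both attained by a suitable
      class \<open>r\<close>.\<close>
    have "(i + (2 * i) mod 3) mod 3 = 0" "(i + (2 * i + 1) mod 3) mod 3 = 1" by presburger+
    then show "T 0 = 0 \<and> T 1 = 0"
      using *[rule_format, of "(2 * i) mod 3"] *[rule_format, of "(2 * i + 1) mod 3"] by simp
  qed
  finally show ?thesis using T_eq by auto
qed

section \<open>Uniqueness and existence of \<open>P_{n,n}\<close>\<close>

text \<open>The difference of two candidates solves the homogeneous conditions with coefficient 0 at
  \<open>2 * n\<close>, and so do its real and imaginary parts. A nonzero real solution in some
  class would have to lie in the class of \<open>2 * n\<close> with all coefficients nonzero,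
  including that one.\<close>

lemma is_diag_mop_unique:
  assumes "is_diag_mop n p" "is_diag_mop n q"
  shows "p = q"
proof (rule poly_eqI)
  fix m
  define D where "D = p - q"
  have pq: "degree p = 2 * n" "degree q = 2 * n" "coeff p (2 * n) = 1" "coeff q (2 * n) = 1"
    using assms by (auto simp: is_diag_mop_def)
  then have D_top: "coeff D (2 * n) = 0" by (simp add: D_def)
  have orth: "(\<Sum>k\<in>coeff_exps n r. of_real (moment (i + k)) * coeff D k) = 0"
    if "r < 3" "i \<in> test_exps n r" for r i
    using assms that rays_orthogonal_iff[of p n i] rays_orthogonal_iff[of q n i] pq(1,2)
    unfolding is_diag_mop_def test_exps_def
    by (auto simp: D_def right_diff_distrib sum_subtractf)
  show "coeff p m = coeff q m"
  proof (cases "m \<le> 2 * n")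
    case True
    define r where "r = m mod 3"
    have r: "r < 3" "m \<in> coeff_exps n r" using True by (auto simp: r_def coeff_exps_def)
    have zero: "c m = 0"
      if c: "\<forall>i\<in>test_exps n r. (\<Sum>k\<in>coeff_exps n r. moment (i + k) * c k) = 0" "c (2 * n) = 0"
      for c
    proof (rule ccontr)
      assume "c m \<noteq> 0"
      with r(2) have "\<exists>k\<in>coeff_exps n r. c k \<noteq> 0" by blast
      note * = orthogonal_coeffs[OF r(1) c(1) this]
      from *(1) have "2 * n \<in> coeff_exps n r" by (simp add: coeff_exps_def)
      then show False using *(2) c(2) by blast
    qed
    have "Re (coeff D m) = 0"
    proof (rule zero)
      show "\<forall>i\<in>test_exps n r. (\<Sum>k\<in>coeff_exps n r. moment (i + k) * Re (coeff D k)) = 0"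
      proof
        fix i assume "i \<in> test_exps n r"
        from arg_cong[OF orth[OF r(1) this], of Re]
        show "(\<Sum>k\<in>coeff_exps n r. moment (i + k) * Re (coeff D k)) = 0" by simp
      qed
    qed (simp add: D_top)
    moreover have "Im (coeff D m) = 0"
    proof (rule zero)
      show "\<forall>i\<in>test_exps n r. (\<Sum>k\<in>coeff_exps n r. moment (i + k) * Im (coeff D k)) = 0"
      proof
        fix i assume "i \<in> test_exps n r"
        from arg_cong[OF orth[OF r(1) this], of Im]
        show "(\<Sum>k\<in>coeff_exps n r. moment (i + k) * Im (coeff D k)) = 0" by simp
      qed
    qed (simp add: D_top)
    ultimately show ?thesis by (simp add: D_def complex_eq_iff)
  next
    case False
    then show ?thesis using pq by (simp add: coeff_eq_0)
  qed
qed

text \<open>In the class of \<open>2 * n\<close> there is one more coefficient than there are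
  conditions, so a nontrivial real solution exists. Its coefficient at \<open>2 * n\<close> is
  nonzero, which permits normalisation; the other classes are filled with zeros.\<close>

lemma diag_mop_real:
  fixes n :: nat
  defines "r \<equiv> 2 * n mod 3"
  obtains c :: "nat \<Rightarrow> real" where
    "diag_mop n = poly_on (coeff_exps n r) (\<lambda>k. of_real (c k))"
    "\<forall>k\<in>coeff_exps n r. c k \<noteq> 0"
    "card {x. x > 0 \<and> poly (poly_on (coeff_exps n r) c) x = 0} = card (test_exps n r)"
proof -
  have r: "r < 3" by (simp add: r_def)
  have top: "2 * n \<in> coeff_exps n r" by (simp add: coeff_exps_def r_def)
  have "card (test_exps n r) < card (coeff_exps n r)" using card_exps[OF r, of n] by (simp add: r_def)
  from homogeneous_system_nontrivial[OF _ _ this, of "\<lambda>i k. moment (i + k)"]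
  obtain b where b: "\<exists>k\<in>coeff_exps n r. b k \<noteq> 0"
    "\<forall>i\<in>test_exps n r. (\<Sum>k\<in>coeff_exps n r. moment (i + k) * b k) = 0" by auto
  have b_top: "b (2 * n) \<noteq> 0" using orthogonal_coeffs(2)[OF r b(2,1)] top by blast
  define c where "c k = b k / b (2 * n)" for k
  have c: "\<forall>i\<in>test_exps n r. (\<Sum>k\<in>coeff_exps n r. moment (i + k) * c k) = 0"
    using b(2) by (simp add: c_def sum_divide_distrib[symmetric])
  have c_top: "c (2 * n) = 1" using b_top by (simp add: c_def)
  have "\<exists>k\<in>coeff_exps n r. c k \<noteq> 0" using top c_top by (metis zero_neq_one)
  note nz = orthogonal_coeffs(2,3)[OF r c this]
  define p where "p = poly_on (coeff_exps n r) (\<lambda>k. complex_of_real (c k))"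
  have coeff_p: "coeff p k = (if k \<in> coeff_exps n r then of_real (c k) else 0)" for k
    by (simp add: p_def coeff_poly_on)
  have "degree p \<le> 2 * n" by (rule degree_le) (auto simp: coeff_p coeff_exps_def)
  moreover have "2 * n \<le> degree p" using top c_top by (intro le_degree) (simp add: coeff_p)
  ultimately have deg: "degree p = 2 * n" by simp
  have "(\<Sum>k\<in>coeff_exps n s. of_real (moment (i + k)) * coeff p k) = 0"
    if "i < n" "s < 3" "(i + s) mod 3 \<noteq> 2" for i s
  proof (cases "s = r")
    case True
    then have "(\<Sum>k\<in>coeff_exps n s. of_real (moment (i + k)) * coeff p k) =
        complex_of_real (\<Sum>k\<in>coeff_exps n r. moment (i + k) * c k)"
      by (simp add: coeff_p)
    also have "(\<Sum>k\<in>coeff_exps n r. moment (i + k) * c k) = 0"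
      using c that True by (simp add: test_exps_def)
    finally show ?thesis by simp
  next
    case False
    then show ?thesis by (intro sum.neutral) (auto simp: coeff_p coeff_exps_def)
  qed
  then have "\<forall>j\<in>{1, 2}. rays_integral j (\<lambda>x. x ^ i * poly p x * exp (- (x ^ 3))) = 0"
    if "i < n" for i
    using rays_orthogonal_iff[of p n i] deg that by simp
  then have "is_diag_mop n p"
    unfolding is_diag_mop_def using deg top c_top by (auto simp: coeff_p)
  then have "diag_mop n = p"
    unfolding diag_mop_def using is_diag_mop_unique by (intro the_equality) auto
  then show ?thesis using that[of c] nz unfolding p_def by blast
qed

section \<open>Symmetry, explicit form and zeros of \<open>P_{n,n}\<close>\<close>

lemma coeff_exps_eq_image:
  assumes "r = 2 * n mod 3"
  shows "coeff_exps n r = (\<lambda>j. 3 * j + r) ` {0..2 * n div 3}"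
proof (intro set_eqI iffI)
  fix k assume "k \<in> coeff_exps n r"
  then have "k = 3 * (k div 3) + r" "k div 3 \<in> {0..2 * n div 3}"
    by (auto simp: coeff_exps_def div_le_mono)
  then show "k \<in> (\<lambda>j. 3 * j + r) ` {0..2 * n div 3}" by blast
next
  fix k assume "k \<in> (\<lambda>j. 3 * j + r) ` {0..2 * n div 3}"
  then obtain j where k: "k = 3 * j + r" "j \<le> 2 * n div 3" by auto
  then have "k \<le> 2 * n" using mult_div_mod_eq[of 3 "2 * n"] assms by linarith
  moreover have "k mod 3 = r" using k(1) assms by simp
  ultimately show "k \<in> coeff_exps n r" by (simp add: coeff_exps_def)
qed

theorem proposition4p1:
  fixes n :: nat
  shows "(\<forall>x. poly (diag_mop n) (omega * x) = omega ^ (2 * n) * poly (diag_mop n) x)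
    \<and> (n mod 3 = 0 \<longrightarrow> (\<exists>a :: nat \<Rightarrow> real. \<forall>x.
          poly (diag_mop n) x = (\<Sum>j = 0..2 * n div 3. of_real (a j) * x ^ (3 * j))))
    \<and> (n mod 3 = 1 \<longrightarrow> (\<exists>b :: nat \<Rightarrow> real. \<forall>x.
          poly (diag_mop n) x = x ^ 2 * (\<Sum>j = 0..2 * (n - 1) div 3. of_real (b j) * x ^ (3 * j))))
    \<and> (n mod 3 = 2 \<longrightarrow> (\<exists>c :: nat \<Rightarrow> real. \<forall>x.
          poly (diag_mop n) x = x * (\<Sum>j = 0..2 * (n - 2) div 3 + 1. of_real (c j) * x ^ (3 * j))))
    \<and> card {x :: real. x > 0 \<and> poly (diag_mop n) (of_real x) = 0} =
        (if n mod 3 = 0 then 2 * n div 3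
         else if n mod 3 = 1 then 2 * (n - 1) div 3
         else 2 * (n - 2) div 3 + 1)
    \<and> (n mod 3 = 2 \<longrightarrow> order 0 (diag_mop n) = 1)
    \<and> (n mod 3 = 1 \<longrightarrow> order 0 (diag_mop n) = 2)"
proof -
  define r where "r = 2 * n mod 3"
  define d where "d = 2 * n div 3"
  obtain c :: "nat \<Rightarrow> real" where
    P: "diag_mop n = poly_on (coeff_exps n r) (\<lambda>k. of_real (c k))" and
    nz: "\<forall>k\<in>coeff_exps n r. c k \<noteq> 0" and
    roots: "card {x. x > 0 \<and> poly (poly_on (coeff_exps n r) c) x = 0} = card (test_exps n r)"
    using diag_mop_real[of n] unfolding r_def by blast
  have exps: "coeff_exps n r = (\<lambda>j. 3 * j + r) ` {0..d}"
    unfolding d_def by (rule coeff_exps_eq_image) (simp add: r_def)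
  have rep: "poly (diag_mop n) x = x ^ r * (\<Sum>j = 0..d. of_real (c (3 * j + r)) * x ^ (3 * j))" for x
    unfolding P poly_on_def exps
    by (simp add: poly_sum poly_monom sum.reindex inj_on_def sum_distrib_left power_add mult_ac)
  have w3: "omega ^ (3 * j) = 1" for j by (simp add: power_mult omega_cubed)
  have "2 * n = 3 * d + r" by (simp add: d_def r_def)
  then have "omega ^ (2 * n) = omega ^ r" by (simp add: power_add w3)
  then have sym: "poly (diag_mop n) (omega * x) = omega ^ (2 * n) * poly (diag_mop n) x" for x
    unfolding rep by (simp add: power_mult_distrib w3)
  have "poly (diag_mop n) (of_real x) = of_real (poly (poly_on (coeff_exps n r) c) x)" for x
    by (simp add: P poly_on_def poly_sum poly_monom)
  then have "card {x :: real. x > 0 \<and> poly (diag_mop n) (of_real x) = 0} = card (test_exps n r)"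
    using roots by simp
  \<comment> \<open>The class has \<open>d + 1\<close> exponents, one more than it has
    conditions.\<close>
  also have "card (test_exps n r) = d"
    using card_exps[of r n] unfolding exps by (simp add: r_def card_image inj_on_def)
  finally have card: "card {x :: real. x > 0 \<and> poly (diag_mop n) (of_real x) = 0} = d" .
  have coeff: "coeff (diag_mop n) k = (if k \<in> coeff_exps n r then of_real (c k) else 0)" for k
    by (simp add: P coeff_poly_on)
  have r_in: "r \<in> coeff_exps n r" by (simp add: coeff_exps_def r_def)
  then have P0: "diag_mop n \<noteq> 0" using nz coeff by (metis coeff_0 of_real_eq_0_iff)
  have "k \<notin> coeff_exps n r" if "k < r" for k
    using that by (auto simp: coeff_exps_def r_def)
  \<comment> \<open>The order at 0 is the lowest exponent present, and the coefficient at
    \<open>r\<close> is nonzero.\<close>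
  then have "r \<le> order 0 (diag_mop n)"
    using P0 by (simp add: monom_1_dvd_iff[symmetric] monom_1_dvd_iff' coeff)
  moreover have "\<not> Suc r \<le> order 0 (diag_mop n)"
    using P0 r_in nz by (auto simp: monom_1_dvd_iff[symmetric] monom_1_dvd_iff' coeff)
  ultimately have ord: "order 0 (diag_mop n) = r" by simp
  \<comment> \<open>Doubling swaps the residues 1 and 2, hence the double zero for
    \<open>n mod 3 = 1\<close>. The natural subtractions below do not truncate, and the divisions by
    3 are exact.\<close>
  have c0: "r = 0" "d = 2 * n div 3" if "n mod 3 = 0"
    using that by (simp_all add: r_def d_def) presburger
  have c1: "r = 2" "d = 2 * (n - 1) div 3" if "n mod 3 = 1"
    using that unfolding r_def d_def by presburger+
  have c2: "r = 1" "d = 2 * (n - 2) div 3 + 1" if "n mod 3 = 2"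
    using that unfolding r_def d_def by presburger+
  have nmod: "n mod 3 = 0 \<or> n mod 3 = 1 \<or> n mod 3 = 2" by presburger
  show ?thesis
  proof (intro conjI impI)
    assume n: "n mod 3 = 0"
    show "\<exists>a :: nat \<Rightarrow> real. \<forall>x.
        poly (diag_mop n) x = (\<Sum>j = 0..2 * n div 3. of_real (a j) * x ^ (3 * j))"
      using rep unfolding c0[OF n] by (intro exI[of _ "\<lambda>j. c (3 * j + 0)"]) simp
  next
    assume n: "n mod 3 = 1"
    show "\<exists>b :: nat \<Rightarrow> real. \<forall>x.
        poly (diag_mop n) x = x ^ 2 * (\<Sum>j = 0..2 * (n - 1) div 3. of_real (b j) * x ^ (3 * j))"
      using rep unfolding c1[OF n] by (intro exI[of _ "\<lambda>j. c (3 * j + 2)"]) simp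
  next
    assume n: "n mod 3 = 2"
    show "\<exists>c :: nat \<Rightarrow> real. \<forall>x.
        poly (diag_mop n) x = x * (\<Sum>j = 0..2 * (n - 2) div 3 + 1. of_real (c j) * x ^ (3 * j))"
      using rep unfolding c2[OF n] by (intro exI[of _ "\<lambda>j. c (3 * j + 1)"]) simp
  qed (use sym card ord c0 c1 c2 nmod in auto)
qed

end
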